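(* Vertex covers can be taught in $O(n^2)$ rounds: for every graph $G$ with vertex set $V=\{1,\dots,n\}$ there exist a set $P_G$ of positive examples and a set $N_G$ of negative examples for the vertex cover concept with $|P_G|+|N_G|=O(n^2)$, such that every graph $H$ on $V$ consistent with these examples has exactly the same vertex covers as $G$.
   Context: A vertex cover of $G$ is a set of vertices containing at least one endpoint of every edge. Teaching model: for a vertex set concept $\Phi$ and a graph $G$ on $V$, a positive example is a set $V'\subseteq V$ with $\Phi(G,V')$ true, and a negative example is a set $V'\subseteq V$ with $\Phi(G,V')$ false. A graph $H$ on $V$ is consistent with example sets $P,N$ if $\Phi(H,V')$ holds for every $V'\in P$ and fails for every $V'\in N$. The concept can be taught in $g(n)$ rounds if, for every graph $G$ of order $n$, there exist $P_G,N_G$ with $|P_G|+|N_G|\le g(n)$ such that every graph $H$ on $V$ consistent with $P_G,N_G$ is $\Phi$-equivalent to $G$, i.e. $\{V':\Phi(H,V')\}=\{V':\Phi(G,V')\}$. *)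

theory Defs
  imports Complex_Main "HOL-Library.Landau_Symbols"
begin

record 'a ugraph =
  verts :: "'a set"
  edges :: "'a set set"

definition simple_graph :: "'a ugraph \<Rightarrow> bool" where
  "simple_graph G \<longleftrightarrow> finite (verts G) \<and> (\<forall>e\<in>edges G. e \<subseteq> verts G \<and> card e = 2)"

type_synonym 'a vertex_set_concept = "'a ugraph \<Rightarrow> 'a set \<Rightarrow> bool"

definition vertex_cover :: "'a vertex_set_concept" where
  "vertex_cover G C \<longleftrightarrow> C \<subseteq> verts G \<and> (\<forall>e\<in>edges G. e \<inter> C \<noteq> {})"

definition positive_example :: "'a vertex_set_concept \<Rightarrow> 'a ugraph \<Rightarrow> 'a set \<Rightarrow> bool" where
  "positive_example \<Phi> G X \<longleftrightarrow> X \<subseteq> verts G \<and> \<Phi> G X"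

definition negative_example :: "'a vertex_set_concept \<Rightarrow> 'a ugraph \<Rightarrow> 'a set \<Rightarrow> bool" where
  "negative_example \<Phi> G X \<longleftrightarrow> X \<subseteq> verts G \<and> \<not> \<Phi> G X"

definition consistent_with ::
  "'a vertex_set_concept \<Rightarrow> 'a ugraph \<Rightarrow> 'a set set \<Rightarrow> 'a set set \<Rightarrow> bool" where
  "consistent_with \<Phi> H P N \<longleftrightarrow> (\<forall>X\<in>P. \<Phi> H X) \<and> (\<forall>X\<in>N. \<not> \<Phi> H X)"

definition concept_equivalent ::
  "'a vertex_set_concept \<Rightarrow> 'a ugraph \<Rightarrow> 'a ugraph \<Rightarrow> bool" where
  "concept_equivalent \<Phi> H G \<longleftrightarrow>
     {X. X \<subseteq> verts H \<and> \<Phi> H X} = {X. X \<subseteq> verts G \<and> \<Phi> G X}"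

text \<open>
  A graph of order \<open>n\<close> is a labelled graph on \<open>{1..n}\<close>. The example sets may depend on the
  graph, but the bound \<open>g\<close> may depend only on \<open>n\<close>. Examples are subsets of the finite vertex
  set, so \<open>P\<close> and \<open>N\<close> are finite and their cardinalities are meaningful.
\<close>
definition teachable_in_rounds :: "nat vertex_set_concept \<Rightarrow> (nat \<Rightarrow> nat) \<Rightarrow> bool" where
  "teachable_in_rounds \<Phi> g \<longleftrightarrow>
     (\<forall>n G. simple_graph G \<and> verts G = {1..n} \<longrightarrow>
       (\<exists>P N. (\<forall>X\<in>P. positive_example \<Phi> G X) \<and> (\<forall>X\<in>N. negative_example \<Phi> G X) \<and>
          card P + card N \<le> g n \<and>
          (\<forall>H. simple_graph H \<and> verts H = {1..n} \<and> consistent_with \<Phi> H P N \<longrightarrow>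
             concept_equivalent \<Phi> H G)))"

end

theory Submission imports Defs begin

text \<open>
  The complement of a pair \<open>e\<close> of distinct vertices is a vertex cover exactly when \<open>e\<close> is not
  an edge. Hence the complements of all pairs, labelled positive or negative according to \<open>G\<close>,
  determine every edge of \<open>G\<close>, using \<open>n choose 2\<close> examples.
\<close>

lemma vertex_cover_Diff_pair_iff:
  assumes "simple_graph G" and "card e = 2"
  shows "vertex_cover G (verts G - e) \<longleftrightarrow> e \<notin> edges G"
proof
  assume "vertex_cover G (verts G - e)"
  then show "e \<notin> edges G"
    by (auto simp: vertex_cover_def)
next
  assume e: "e \<notin> edges G"
  have "f \<inter> (verts G - e) \<noteq> {}" if f: "f \<in> edges G" for f
  proof
    assume "f \<inter> (verts G - e) = {}"
    moreover have "f \<subseteq> verts G" "card f = 2"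
      using assms(1) f by (auto simp: simple_graph_def)
    \<comment> \<open>An edge that misses the complement of \<open>e\<close> lies inside
      \<open>e\<close>; since both have two elements, they coincide.\<close>
    ultimately have "f \<subseteq> e" by blast
    moreover have "finite e"
      using assms(2) by (simp add: card_ge_0_finite)
    ultimately have "f = e"
      using \<open>card f = 2\<close> assms(2) by (simp add: card_subset_eq)
    then show False
      using e f by simp
  qed
  then show "vertex_cover G (verts G - e)"
    by (simp add: vertex_cover_def)
qed

text \<open>Since \<open>H\<close> and \<open>G\<close> share their vertices, the complement of a
  pair is the same set in both graphs, so its label decides whether the pair is an edge of
  \<open>H\<close>. The negative examples force the edges of \<open>G\<close> into \<open>H\<close>,
  and the positive ones exclude every other pair.\<close>

lemma consistent_with_pair_complements_imp_edges_eq: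
  assumes G: "simple_graph G" and H: "simple_graph H" "verts H = verts G"
    and Q: "Q = {e. e \<subseteq> verts G \<and> card e = 2}"
    and con: "consistent_with vertex_cover H
      ((\<lambda>e. verts G - e) ` (Q - edges G)) ((\<lambda>e. verts G - e) ` edges G)"
  shows "edges H = edges G"
proof -
  have sub: "edges G \<subseteq> Q" "edges H \<subseteq> Q"
    using G H Q by (auto simp: simple_graph_def)
  have iff: "vertex_cover H (verts G - e) \<longleftrightarrow> e \<notin> edges H" if "e \<in> Q" for e
    using vertex_cover_Diff_pair_iff[OF H(1), of e] H(2) Q that by simp
  show ?thesis
    using con sub iff unfolding consistent_with_def by blast
qed

lemma teachable_in_rounds_vertex_cover:
  "teachable_in_rounds vertex_cover (\<lambda>n. n choose 2)"
  unfolding teachable_in_rounds_def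
proof (intro allI impI, elim conjE)
  fix n and G :: "nat ugraph"
  assume G: "simple_graph G" "verts G = {1..n}"
  define Q where "Q = {e. e \<subseteq> verts G \<and> card e = 2}"
  define P where "P = (\<lambda>e. verts G - e) ` (Q - edges G)"
  define N where "N = (\<lambda>e. verts G - e) ` edges G"
  have sub: "edges G \<subseteq> Q"
    using G by (auto simp: simple_graph_def Q_def)
  have fin: "finite Q"
    using G by (auto simp: Q_def)
  \<comment> \<open>\<open>P\<close> and \<open>N\<close> are images of the two blocks of a
    partition of \<open>Q\<close>, so together they have at most \<open>card Q\<close>
    elements.\<close>
  have "card P + card N \<le> card (Q - edges G) + card (edges G)"
    unfolding P_def N_def using fin sub
    by (intro add_mono card_image_le) (auto intro: finite_subset)
  also have "\<dots> = card Q"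
    using fin sub by (metis card_Diff_subset card_mono finite_subset le_add_diff_inverse2)
  also have "\<dots> = n choose 2"
    using n_subsets[of "verts G" 2] G by (simp add: Q_def)
  finally have card: "card P + card N \<le> n choose 2" .
  have iff: "vertex_cover G (verts G - e) \<longleftrightarrow> e \<notin> edges G" if "e \<in> Q" for e
    using vertex_cover_Diff_pair_iff[OF G(1)] that by (simp add: Q_def)
  have pos: "\<forall>X\<in>P. positive_example vertex_cover G X"
    using iff by (auto simp: P_def positive_example_def)
  have neg: "\<forall>X\<in>N. negative_example vertex_cover G X"
    using iff sub by (auto simp: N_def negative_example_def)
  have "concept_equivalent vertex_cover H G"
    if H: "simple_graph H" "verts H = {1..n}" "consistent_with vertex_cover H P N" for H
  proof -
    have "verts H = verts G"
      using G H by simp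
    moreover from this have "edges H = edges G"
      using consistent_with_pair_complements_imp_edges_eq[OF G(1) H(1) _ Q_def] H(3)
      by (simp add: P_def N_def)
    \<comment> \<open>Whether a set is a vertex cover depends on the graph only through
      \<open>verts\<close> and \<open>edges\<close>.\<close>
    ultimately show ?thesis
      by (simp add: concept_equivalent_def vertex_cover_def)
  qed
  then show "\<exists>P N. (\<forall>X\<in>P. positive_example vertex_cover G X) \<and>
      (\<forall>X\<in>N. negative_example vertex_cover G X) \<and> card P + card N \<le> n choose 2 \<and>
      (\<forall>H. simple_graph H \<and> verts H = {1..n} \<and> consistent_with vertex_cover H P N \<longrightarrow>
        concept_equivalent vertex_cover H G)"
    using pos neg card by blast
qed

theorem theorem3p1:
  "\<exists>g :: nat \<Rightarrow> nat. (\<lambda>n. real (g n)) \<in> O(\<lambda>n. real n ^ 2) \<and>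
     teachable_in_rounds vertex_cover g"
proof (intro exI conjI)
  have "n choose 2 \<le> n ^ 2" for n :: nat
    \<comment> \<open>\<open>binomial_le_pow\<close> requires \<open>2 \<le> n\<close>; for smaller
      \<open>n\<close> the binomial coefficient is 0.\<close>
    by (cases "2 \<le> n") (simp_all add: binomial_le_pow binomial_eq_0)
  then have "real (n choose 2) \<le> real n ^ 2" for n :: nat
    by (metis of_nat_le_iff of_nat_power)
  \<comment> \<open>This goal fixes the witness \<open>g\<close> as \<open>n choose 2\<close>; the
    constant 1 works for every \<open>n\<close>.\<close>
  then show "(\<lambda>n. real (n choose 2)) \<in> O(\<lambda>n. real n ^ 2)"
    by (intro bigoI[of _ 1]) simp
qed (rule teachable_in_rounds_vertex_cover)

end
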